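(* Fix integers $q \geq r \geq 2$ and a real number $0 < c \leq 1$. Then $\operatorname{F}_{r,s,q}(n) = \Theta(s n^r)$ for $s \geq c n^{r-1}$, where the constant in the lower bound depends on $c$, $r$, and $q$.
   Context: All sequences are finite. A sequence is $j$-sparse if every contiguous subsequence of length $j$ has all letters distinct. An $(r,s)$-formation is a concatenation of $s$ permutations of the same $r$ distinct letters. A sequence avoids all $(r,s)$-formations if no (not necessarily contiguous) subsequence of it is an $(r,s)$-formation on some $r$ of its letters. $\operatorname{F}_{r,s,j}(n)$ denotes the maximum possible length of a $j$-sparse sequence with $n$ distinct letters that avoids all $(r,s)$-formations. The parameters $n$ and $s$ are positive integers. The asymptotic statement is as $n \to \infty$, uniformly over all integers $s$ satisfying the stated inequality: $\Theta(s n^r)$ means bounded above and below by positive constants times $s n^r$ for all sufficiently large $n$ and all such $s$; the constants do not depend on $s$ or $n$, and only the lower-bound constant depends on the parameters listed. *)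

theory Defs
  imports Complex_Main "HOL-Library.Sublist" "HOL-Combinatorics.Multiset_Permutations"
begin

definition sparse :: "nat \<Rightarrow> 'a list \<Rightarrow> bool" where
  "sparse j u \<longleftrightarrow> (\<forall>v. sublist v u \<and> length v = j \<longrightarrow> distinct v)"

definition formation :: "nat \<Rightarrow> nat \<Rightarrow> 'a list \<Rightarrow> bool" where
  "formation r s u \<longleftrightarrow>
     (\<exists>X ps. finite X \<and> card X = r \<and> length ps = s \<and>
        set ps \<subseteq> permutations_of_set X \<and> u = concat ps)"

definition avoids_formations :: "nat \<Rightarrow> nat \<Rightarrow> 'a list \<Rightarrow> bool" where
  "avoids_formations r s u \<longleftrightarrow> \<not> (\<exists>v. subseq v u \<and> formation r s v)"

definition admissible_lengths :: "nat \<Rightarrow> nat \<Rightarrow> nat \<Rightarrow> nat \<Rightarrow> nat set" where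
  "admissible_lengths r s j n =
     {length u | u :: nat list. sparse j u \<and> card (set u) = n \<and> avoids_formations r s u}"

text \<open>Letters are natural numbers without loss of generality. The maximum is only meaningful if
  the set of lengths is finite and nonempty; lemmas \<open>finite_admissible_lengths\<close> and
  \<open>admissible_lengths_nonempty\<close> below show that this is the case when
  \<open>1 \<le> r \<le> j\<close> and \<open>s \<ge> 2\<close>.\<close>

definition F :: "nat \<Rightarrow> nat \<Rightarrow> nat \<Rightarrow> nat \<Rightarrow> nat" where
  "F r s j n = Max (admissible_lengths r s j n)"

lemma subseq_concat_filter:
  "subseq (concat (map b (filter P ks))) (concat (map b ks))"
proof (induction ks)
  case (Cons a ks)
  then show ?case by (auto intro: list_emb_append_mono)
qed simp

lemma concat_blocks: "concat (map (\<lambda>i. take r (drop (r * i) u)) [0..<m]) = take (r * m) u"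
proof (induction m)
  case (Suc m)
  have "r * Suc m = r * m + r" by simp
  then show ?case using Suc by (simp only: take_add) simp
qed simp

lemma length_less_of_avoids:
  fixes u :: "'a list"
  assumes "1 \<le> r" "r \<le> j" "1 \<le> s" "sparse j u" "avoids_formations r s u" "j \<le> length u"
  shows "length u < r * (s * 2 ^ card (set u))"
proof (rule ccontr)
  define K where "K = (2::nat) ^ card (set u)"
  define b where "b i = take r (drop (r * i) u)" for i
  define m where "m = s * K"
  assume "\<not> ?thesis"
  then have long: "r * m \<le> length u" by (simp add: m_def K_def)
  have Kpos: "K > 0" by (simp add: K_def)
  have blk: "length (b i) = r \<and> distinct (b i)" if "i < m" for i
  proof
    have "r * Suc i \<le> r * m" using that by (intro mult_le_mono2) simp
    then have le: "r * i + r \<le> length u" using long by simp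
    then show "length (b i) = r" by (simp add: b_def)
    define k where "k = min (r * i) (length u - j)"
    have "sublist (take j (drop k u)) u"
      by (rule sublist_order.order_trans[OF sublist_take sublist_drop])
    moreover have "length (take j (drop k u)) = j"
      using assms(6) by (simp add: k_def)
    ultimately have d: "distinct (take j (drop k u))"
      using assms(4) by (auto simp: sparse_def)
    have "b i = take r (drop (r * i - k) (take j (drop k u)))"
      using le assms(2) by (auto simp: b_def k_def drop_take min_def)
    then show "distinct (b i)" using d by simp
  qed
  define I where "I X = filter (\<lambda>i. set (b i) = X) [0..<m]" for X
  have "\<exists>X\<in>Pow (set u). s \<le> length (I X)"
  proof (rule ccontr)
    assume none: "\<not> (\<exists>X\<in>Pow (set u). s \<le> length (I X))"
    have small: "length (I X) \<le> s - 1" if "X \<in> Pow (set u)" for X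
    proof -
      have "\<not> s \<le> length (I X)" using none that by blast
      then show ?thesis by linarith
    qed
    have "{..<m} \<subseteq> (\<Union>X\<in>Pow (set u). set (I X))"
    proof
      fix i assume "i \<in> {..<m}"
      moreover have "set (b i) \<subseteq> set u"
        unfolding b_def by (meson order_trans set_take_subset set_drop_subset)
      ultimately show "i \<in> (\<Union>X\<in>Pow (set u). set (I X))" by (simp add: I_def)
    qed
    then have "m \<le> card (\<Union>X\<in>Pow (set u). set (I X))"
      using card_mono[of "\<Union>X\<in>Pow (set u). set (I X)" "{..<m}"] by simp
    also have "\<dots> \<le> (\<Sum>X\<in>Pow (set u). card (set (I X)))"
      by (intro card_UN_le) simp
    also have "\<dots> \<le> (\<Sum>X\<in>Pow (set u). s - 1)"
      by (intro sum_mono order_trans[OF card_length] small)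
    also have "\<dots> = K * (s - 1)" by (simp add: K_def card_Pow)
    also have "\<dots> < K * s" using Kpos assms(3) by simp
    finally show False by (simp add: m_def mult.commute)
  qed
  then obtain X where X: "s \<le> length (I X)" by blast
  define ps where "ps = map b (take s (I X))"
  have len: "length ps = s" using X by (simp add: ps_def)
  have inI: "i < m \<and> set (b i) = X" if "i \<in> set (I X)" for i
    using that by (auto simp: I_def)
  have perms: "set ps \<subseteq> permutations_of_set X"
    using inI blk by (auto simp: ps_def permutations_of_set_def dest!: in_set_takeD)
  obtain i where "i \<in> set (I X)" using X assms(3) by (cases "I X") auto
  then have "card X = r" "finite X" using inI blk distinct_card by fastforce+
  then have "formation r s (concat ps)"
    using len perms by (auto simp: formation_def)
  moreover have "subseq (concat ps) u"
  proof -
    have "concat (map b (I X)) = concat ps @ concat (map b (drop s (I X)))"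
      unfolding ps_def by (metis append_take_drop_id concat_append map_append)
    then have "subseq (concat ps) (concat (map b (I X)))" by (auto intro: prefix_imp_subseq)
    also have "subseq \<dots> (concat (map b [0..<m]))"
      unfolding I_def by (rule subseq_concat_filter)
    also have "concat (map b [0..<m]) = take (r * m) u"
      unfolding b_def by (rule concat_blocks)
    also have "subseq (take (r * m) u) u"
      by (intro sublist_imp_subseq sublist_take)
    finally show ?thesis .
  qed
  ultimately show False using assms(5) by (auto simp: avoids_formations_def)
qed

lemma finite_admissible_lengths:
  assumes "1 \<le> r" "r \<le> j" "1 \<le> s"
  shows "finite (admissible_lengths r s j n)"
proof (rule finite_subset)
  show "admissible_lengths r s j n \<subseteq> {..j + r * (s * 2 ^ n)}"
  proof
    fix l assume "l \<in> admissible_lengths r s j n"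
    then obtain u :: "nat list" where u: "l = length u" "sparse j u" "card (set u) = n"
      "avoids_formations r s u" by (auto simp: admissible_lengths_def)
    show "l \<in> {..j + r * (s * 2 ^ n)}"
      using length_less_of_avoids[OF assms u(2,4)] u by (cases "j \<le> length u") auto
  qed
qed simp

lemma distinct_subseq: "subseq v u \<Longrightarrow> distinct u \<Longrightarrow> distinct v"
  by (auto simp: subseq_conv_nths)

lemma admissible_lengths_nonempty:
  assumes "1 \<le> r" "2 \<le> s"
  shows "admissible_lengths r s j n \<noteq> {}"
proof -
  have "\<not> formation r s v" if "subseq v [0..<n]" for v
  proof
    assume "formation r s v"
    then obtain X ps where f: "finite X" "card X = r" "length ps = s"
      "set ps \<subseteq> permutations_of_set X" "v = concat ps" by (auto simp: formation_def)
    obtain p p' ps' where ps: "ps = p # p' # ps'"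
      using f(3) assms(2) by (cases ps; cases "tl ps") auto
    have "set p = X" "set p' = X" using f(4) ps by (auto simp: permutations_of_set_def)
    moreover have "X \<noteq> {}" using f(2) assms(1) by auto
    moreover have "distinct v" using that distinct_subseq by force
    ultimately show False using f(5) ps by auto
  qed
  then have "length [0..<n] \<in> admissible_lengths r s j n"
    unfolding admissible_lengths_def sparse_def avoids_formations_def
    by (intro CollectI exI[of _ "[0..<n]"]) (auto intro: distinct_subseq[OF sublist_imp_subseq distinct_upt])
  then show ?thesis by blast
qed

end

theory Submission
  imports Defs "HOL-Computational_Algebra.Polynomial" "HOL-Library.FuncSet"
begin

text \<open>
  Upper bound: cut a \<open>q\<close>-sparse sequence into consecutive chunks of \<open>r\<close> letters. Since
  \<open>r \<le> q\<close>, the letters of a chunk are distinct, and \<open>s\<close> chunks with the same letter set would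
  form an \<open>(r, s)\<close>-formation. As there are \<open>n choose r\<close> possible letter sets, the length is below
  \<open>r * s * (n choose r) \<le> s * n ^ r\<close> (lemma \<open>length_less_binomial\<close>); the constant is \<open>1\<close>.

  Lower bound: take a family of \<open>q\<close>-sets (\<^emph>\<open>rows\<close>), any two of which share fewer than \<open>r\<close>
  letters, repeat each row about \<open>s / 2\<close> times, and concatenate the results. How many permutations
  of an \<open>r\<close>-set \<open>Y\<close> occur one after the other in this sequence? At most one row contains \<open>Y\<close>, and
  it contributes about \<open>s / 2\<close> of them. Every other permutation begins in a repeated row
  that meets \<open>Y\<close> and ends in a later one, and each repeated row is the start of at most one of
  these (lemma \<open>length_le_sum_capacity\<close>). So the sequence avoids \<open>(r, s)\<close>-formations as soon as
  fewer than about \<open>s / 2\<close> rows meet \<open>Y\<close>.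

  The rows come from the Reed--Solomon code, over the natural numbers instead of a finite field:
  the row of a polynomial \<open>f\<close> of degree below \<open>r\<close> with coefficients below \<open>m\<close> is the list of the
  pairs \<open>(i, f i)\<close> for \<open>i < q\<close>, encoded as \<open>i + q * f i\<close>. There are \<open>m ^ r\<close> rows, two of them
  agree in fewer than \<open>r\<close> places (lemma \<open>row_unique\<close>), and a letter lies in at most \<open>m ^ (r - 1)\<close>
  rows (lemma \<open>card_rows_through_letter\<close>), since it determines the constant coefficient from
  the others. The sequence runs through the residues modulo \<open>q\<close> cyclically, so it is \<open>q\<close>-sparse
  also where one row gives way to the next. The letters are below \<open>m * q ^ (r + 1)\<close>. Hence
  \<open>m\<close> may be a small constant multiple of \<open>n\<close>, small enough compared with \<open>c\<close> for the number
  \<open>r * m ^ (r - 1)\<close> of rows meeting \<open>Y\<close> to be at most \<open>s / 4\<close>. The length is then at least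
  \<open>q * (s / 4) * m ^ r\<close>, which has order \<open>s * n ^ r\<close>.
\<close>

section \<open>The upper bound\<close>

text \<open>A short contiguous subsequence extends to one of length exactly \<open>j\<close>, provided that the whole
  sequence is long enough.\<close>

lemma sparse_short_sublist_distinct:
  assumes "sparse j u" "j \<le> length u" "sublist v u" "length v \<le> j"
  shows "distinct v"
proof -
  obtain xs ys where u: "u = xs @ v @ ys"
    using assms(3) by (auto simp: sublist_def)
  define k where "k = min (length xs) (length u - j)"
  have "sublist (take j (drop k u)) u"
    by (rule sublist_order.order_trans[OF sublist_take sublist_drop])
  moreover have "length (take j (drop k u)) = j"
    using assms(2) by (simp add: k_def)
  ultimately have d: "distinct (take j (drop k u))"
    using assms(1) by (auto simp: sparse_def)
  have "v = take (length v) (drop (length xs) u)"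
    by (simp add: u)
  also have "\<dots> = take (length v) (drop (length xs - k) (take j (drop k u)))"
  proof -
    have "k \<le> length xs" "length v \<le> j - (length xs - k)"
      using assms(2,4) by (auto simp: k_def min_def u)
    then show ?thesis by (simp add: drop_take)
  qed
  finally show ?thesis
    using d by (metis distinct_take distinct_drop)
qed

lemma length_less_binomial:
  fixes u :: "'a list"
  assumes "1 \<le> r" "r \<le> j" "1 \<le> s" "sparse j u" "avoids_formations r s u"
    and "j \<le> length u" "r \<le> card (set u)"
  shows "length u < r * (s * (card (set u) choose r))"
proof (rule ccontr)
  define K where "K = card (set u) choose r"
  define m where "m = s * K"
  define chunk where "chunk i = take r (drop (r * i) u)" for i
  define T where "T = {X. X \<subseteq> set u \<and> card X = r}"
  assume "\<not> ?thesis"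
  then have long: "r * m \<le> length u" by (simp add: m_def K_def)
  have cardT: "card T = K" by (simp add: T_def K_def n_subsets)
  have Kpos: "K > 0" using assms(7) by (simp add: K_def)
  then have T: "finite T" "T \<noteq> {}" using cardT card_gt_0_iff[of T] by auto
  have chunk: "length (chunk i) = r" "distinct (chunk i)" "set (chunk i) \<subseteq> set u" if "i < m" for i
  proof -
    have "r * Suc i \<le> r * m" using that by (intro mult_le_mono2) simp
    then show len: "length (chunk i) = r" using long by (simp add: chunk_def)
    have sub: "sublist (chunk i) u"
      unfolding chunk_def by (rule sublist_order.order_trans[OF sublist_take sublist_drop])
    then show "distinct (chunk i)"
      using sparse_short_sublist_distinct[OF assms(4,6)] len assms(2) by simp
    show "set (chunk i) \<subseteq> set u"
      using sub by (rule set_mono_sublist)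
  qed
  have "(\<lambda>i. set (chunk i)) \<in> {..<m} \<rightarrow> T"
    using chunk by (auto simp: T_def distinct_card)
  then obtain X where X: "X \<in> T"
    and "card ((\<lambda>i. set (chunk i)) -` {X} \<inter> {..<m}) * card T \<ge> card {..<m}"
    using pigeonhole_card[of "\<lambda>i. set (chunk i)" "{..<m}" T] T by blast
  then have many: "s \<le> card ((\<lambda>i. set (chunk i)) -` {X} \<inter> {..<m})"
    using Kpos by (simp add: cardT m_def)
  define I where "I = filter (\<lambda>i. set (chunk i) = X) [0..<m]"
  have "set I = (\<lambda>i. set (chunk i)) -` {X} \<inter> {..<m}" by (auto simp: I_def)
  then have s: "s \<le> length I" using many card_length[of I] by simp
  define ps where "ps = map chunk (take s I)"
  have "set ps \<subseteq> permutations_of_set X"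
    using chunk by (auto simp: ps_def I_def permutations_of_set_def dest!: in_set_takeD)
  moreover have "finite X" "card X = r" using X finite_subset by (auto simp: T_def)
  moreover have "length ps = s" using s by (simp add: ps_def)
  ultimately have "formation r s (concat ps)"
    unfolding formation_def by blast
  moreover have "subseq (concat ps) u"
  proof -
    have "concat (map chunk I) = concat ps @ concat (map chunk (drop s I))"
      unfolding ps_def by (metis append_take_drop_id concat_append map_append)
    then have "subseq (concat ps) (concat (map chunk I))" by (auto intro: prefix_imp_subseq)
    also have "subseq \<dots> (concat (map chunk [0..<m]))"
      unfolding I_def by (rule subseq_concat_filter)
    also have "concat (map chunk [0..<m]) = take (r * m) u"
      unfolding chunk_def by (rule concat_blocks)
    also have "subseq (take (r * m) u) u"
      by (intro sublist_imp_subseq sublist_take)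
    finally show ?thesis .
  qed
  ultimately show False using assms(5) by (auto simp: avoids_formations_def)
qed

lemma mult_binomial_le_power:
  fixes n r :: nat
  shows "r * (n choose r) \<le> n ^ r"
proof -
  have "r * (n choose r) \<le> fact r * (n choose r)"
    by (intro mult_le_mono1 fact_ge_self)
  also have "\<dots> \<le> n ^ r"
    using binomial_fact_pow[of n r] by (simp add: mult.commute)
  finally show ?thesis .
qed

text \<open>The case of length below \<open>q\<close>, where sparsity says nothing, is harmless because \<open>q \<le> n\<close>.\<close>

lemma F_le:
  assumes "1 \<le> r" "r \<le> q" "2 \<le> s" "q \<le> n"
  shows "F r s q n \<le> s * n ^ r"
  unfolding F_def
proof (subst Max_le_iff)
  show "finite (admissible_lengths r s q n)"
    using finite_admissible_lengths assms by simp
  show "admissible_lengths r s q n \<noteq> {}"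
    using admissible_lengths_nonempty assms by simp
  show "\<forall>l\<in>admissible_lengths r s q n. l \<le> s * n ^ r"
  proof
    fix l assume "l \<in> admissible_lengths r s q n"
    then obtain u :: "nat list" where u: "l = length u" "sparse q u" "card (set u) = n"
      "avoids_formations r s u" by (auto simp: admissible_lengths_def)
    show "l \<le> s * n ^ r"
    proof (cases "q \<le> length u")
      case True
      have "l < r * (s * (n choose r))"
        using length_less_binomial[of r q s u] u assms True by simp
      also have "\<dots> = s * (r * (n choose r))" by simp
      also have "\<dots> \<le> s * n ^ r"
        by (intro mult_le_mono2 mult_binomial_le_power)
      finally show ?thesis by simp
    next
      case False
      then have "l \<le> n" using u assms by simp
      also have "n \<le> n ^ r" using assms(1,2,4) by (intro self_le_power) auto
      also have "\<dots> \<le> s * n ^ r" using assms(3) by simp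
      finally show ?thesis .
    qed
  qed
qed

section \<open>Permutations of a set inside a concatenation of blocks\<close>

text \<open>A bound on the number of permutations of \<open>Y\<close> that begin in the block \<open>b\<close>: those that also end
  in it use a new copy of every letter of \<open>Y\<close>, and at most one more ends in a later block.\<close>

definition capacity :: "'a set \<Rightarrow> 'a list \<Rightarrow> nat" where
  "capacity Y b = (if set b \<inter> Y = {} then 0 else Suc (Min (count_list b ` Y)))"

text \<open>A cut through a concatenation damages at most one of its members.\<close>

lemma concat_eq_append_split:
  assumes "concat ps = v @ w"
  shows "\<exists>k x y. v = concat (take k ps) @ x \<and> w = y @ concat (drop (Suc k) ps)"
  using assms
proof (induction ps arbitrary: v)
  case (Cons p ps)
  then have "p @ concat ps = v @ w" by simp
  then consider us where "p @ us = v" "concat ps = us @ w" | us where "p = v @ us" "us @ concat ps = w"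
    by (auto simp: append_eq_append_conv2)
  then show ?case
  proof cases
    case 1
    from Cons.IH[OF 1(2)] obtain k x y
      where "us = concat (take k ps) @ x" "w = y @ concat (drop (Suc k) ps)" by blast
    then show ?thesis using 1 by (intro exI[of _ "Suc k"] exI[of _ x] exI[of _ y]) auto
  next
    case 2
    then show ?thesis by (intro exI[of _ 0] exI[of _ v] exI[of _ us]) auto
  qed
qed auto

lemma length_le_count_list_concat:
  assumes "\<forall>p\<in>set ps. y \<in> set p"
  shows "length ps \<le> count_list (concat ps) y"
  using assms
proof (induction ps)
  case (Cons p ps)
  then have "count_list p y \<noteq> 0" by (simp add: count_list_0_iff)
  then show ?case using Cons by simp
qed simp

lemma subseq_count_list_le:
  assumes "subseq v u"
  shows "count_list v y \<le> count_list u y"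
  unfolding count_list_eq_length_filter
  using list_emb_length[OF subseq_filter[OF assms]] .

lemma length_le_sum_capacity:
  assumes "finite Y" "Y \<noteq> {}" "\<forall>p\<in>set ps. set p = Y" "subseq (concat ps) (concat bs)"
  shows "length ps \<le> (\<Sum>b\<leftarrow>bs. capacity Y b)"
  using assms(3,4)
proof (induction bs arbitrary: ps)
  case Nil
  then have "concat ps = []" by (metis concat.simps(1) list_emb_Nil2)
  then show ?case using Nil.prems(1) assms(2) by (cases ps) auto
next
  case (Cons b bs)
  from Cons.prems(2) obtain v w where vw: "concat ps = v @ w" "subseq v b" "subseq w (concat bs)"
    by (auto elim: subseq_appendE)
  show ?case
  proof (cases "set b \<inter> Y = {}")
    case True
    have "set v \<subseteq> set (concat ps)" by (simp add: vw(1))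
    also have "\<dots> \<subseteq> Y" using Cons.prems(1) by auto
    finally have "set v \<subseteq> Y" .
    moreover have "set v \<subseteq> set b"
      using vw(2) set_nths_subset[of b] by (auto simp: subseq_conv_nths)
    ultimately have "v = []" using True by (cases v) auto
    then show ?thesis using Cons.IH[OF Cons.prems(1)] vw True by (simp add: capacity_def)
  next
    case False
    obtain k x y where cut: "v = concat (take k ps) @ x" "w = y @ concat (drop (Suc k) ps)"
      using concat_eq_append_split[OF vw(1)] by blast
    have "prefix (concat (take k ps)) v" by (simp add: cut(1))
    then have "subseq (concat (take k ps)) b"
      using vw(2) prefix_imp_subseq subseq_order.order_trans by blast
    then have "length (take k ps) \<le> count_list b z" if "z \<in> Y" for z
      using length_le_count_list_concat[of "take k ps" z] subseq_count_list_le[of _ b z]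
        Cons.prems(1) that by (fastforce dest: in_set_takeD)
    then have "length (take k ps) \<le> Min (count_list b ` Y)"
      using assms(1,2) by simp
    moreover have "suffix (concat (drop (Suc k) ps)) w" by (simp add: cut(2) suffix_def)
    then have "subseq (concat (drop (Suc k) ps)) (concat bs)"
      using vw(3) suffix_imp_subseq subseq_order.order_trans by blast
    then have "length (drop (Suc k) ps) \<le> (\<Sum>b\<leftarrow>bs. capacity Y b)"
      using Cons.prems(1) by (intro Cons.IH) (auto dest: in_set_dropD)
    moreover have "length ps \<le> Suc (length (take k ps) + length (drop (Suc k) ps))" by simp
    ultimately show ?thesis using False by (simp add: capacity_def)
  qed
qed

lemma capacity_le:
  assumes "finite Y" "y \<in> Y"
  shows "capacity Y b \<le> Suc (count_list b y)"
  using assms by (auto simp: capacity_def intro: Min_le)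

lemma count_list_distinct_le: "distinct xs \<Longrightarrow> count_list xs y \<le> 1"
  by (induction xs) (auto simp: count_list_0_iff)

lemma count_list_concat_replicate: "count_list (concat (replicate t xs)) y = t * count_list xs y"
  by (induction t) auto

text \<open>If a letter of \<open>Y\<close> is missing from the row, then no permutation of \<open>Y\<close> fits inside the
  repeated row.\<close>

lemma capacity_repeated_le:
  assumes "finite Y" "Y \<noteq> {}" "distinct xs"
  shows "capacity Y (concat (replicate t xs)) \<le>
    (if set xs \<inter> Y \<noteq> {} then 1 else 0) + (if Y \<subseteq> set xs then t else 0)"
proof (cases "set xs \<inter> Y = {}")
  case True
  then have "set (concat (replicate t xs)) \<inter> Y = {}" by (auto simp: set_replicate_conv_if)
  then show ?thesis by (simp add: capacity_def)
next
  case meets: False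
  show ?thesis
  proof (cases "Y \<subseteq> set xs")
    case True
    obtain y where "y \<in> Y" using assms(2) by blast
    then have "capacity Y (concat (replicate t xs)) \<le> Suc (t * count_list xs y)"
      using capacity_le[OF assms(1)] count_list_concat_replicate by metis
    also have "\<dots> \<le> Suc t"
      using mult_le_mono2[OF count_list_distinct_le[OF assms(3)], of t y] by simp
    finally show ?thesis using True meets by simp
  next
    case False
    then obtain y where "y \<in> Y" "y \<notin> set xs" by blast
    then have "capacity Y (concat (replicate t xs)) \<le> Suc 0"
      using capacity_le[OF assms(1), of y "concat (replicate t xs)"]
      by (simp add: count_list_concat_replicate)
    then show ?thesis using False meets by simp
  qed
qed

section \<open>Rows from polynomials\<close>

text \<open>A polynomial is given by its coefficient list, the constant coefficient first.\<close>

definition row :: "nat \<Rightarrow> nat list \<Rightarrow> nat list" where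
  "row q cs = map (\<lambda>i. i + q * poly (Poly cs) i) [0..<q]"

definition coeff_lists :: "nat \<Rightarrow> nat \<Rightarrow> nat list set" where
  "coeff_lists m r = {cs. set cs \<subseteq> {..<m} \<and> length cs = r}"

lemma finite_coeff_lists: "finite (coeff_lists m r)"
  by (simp add: coeff_lists_def finite_lists_length_eq)

lemma card_coeff_lists: "card (coeff_lists m r) = m ^ r"
  by (simp add: coeff_lists_def card_lists_length_eq)

lemma mem_set_row: "x \<in> set (row q cs) \<longleftrightarrow> x mod q < q \<and> x div q = poly (Poly cs) (x mod q)"
proof
  assume "x mod q < q \<and> x div q = poly (Poly cs) (x mod q)"
  then have "x mod q + q * poly (Poly cs) (x mod q) = x" "x mod q \<in> set [0..<q]"
    using mod_mult_div_eq[of x q] by auto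
  then show "x \<in> set (row q cs)"
    unfolding row_def by (metis (no_types, lifting) imageI set_map)
qed (auto simp: row_def)

lemma map_mod_row: "map (\<lambda>x. x mod q) (row q cs) = [0..<q]"
  by (auto simp: row_def intro!: map_idI)

lemma distinct_row: "distinct (row q cs)"
  using map_mod_row distinct_map distinct_upt by metis

lemma poly_of_coeff_list_less:
  assumes "0 < m" "cs \<in> coeff_lists m r" "i < q"
  shows "poly (Poly cs) i < m * q ^ r"
  using assms(2)
proof (induction cs arbitrary: r)
  case Nil
  then show ?case using assms by (simp add: coeff_lists_def)
next
  case (Cons a cs)
  then obtain r' where r: "r = Suc r'" "a < m" "cs \<in> coeff_lists m r'"
    by (auto simp: coeff_lists_def)
  have "i * poly (Poly cs) i \<le> (q - 1) * (m * q ^ r')"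
    using Cons.IH[OF r(3)] assms(3) by (intro mult_le_mono) auto
  moreover have "a < m * q ^ r'"
  proof -
    have "m * 1 \<le> m * q ^ r'" using assms(3) by (intro mult_le_mono2) (simp add: Suc_le_eq)
    then show ?thesis using r(2) by linarith
  qed
  moreover have "m * q ^ r' + (q - 1) * (m * q ^ r') = m * q ^ r"
    using assms(3) by (cases q) (auto simp: r(1) algebra_simps)
  ultimately show ?case by simp
qed

lemma set_row_subset:
  assumes "0 < m" "cs \<in> coeff_lists m r"
  shows "set (row q cs) \<subseteq> {..<m * q ^ (r + 1)}"
proof
  fix x assume "x \<in> set (row q cs)"
  then obtain i where i: "i < q" "x = i + q * poly (Poly cs) i" by (auto simp: row_def)
  have "Suc (poly (Poly cs) i) \<le> m * q ^ r"
    using poly_of_coeff_list_less[OF assms i(1)] by simp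
  then have "q * Suc (poly (Poly cs) i) \<le> q * (m * q ^ r)" by (rule mult_le_mono2)
  then show "x \<in> {..<m * q ^ (r + 1)}" using i by (simp add: algebra_simps)
qed

text \<open>The values are cast to the integers because the bound on the number of roots of a polynomial
  requires an integral domain.\<close>

lemma int_poly_Poly: "int (poly (Poly cs) i) = poly (Poly (map int cs)) (int i)"
  by (induction cs) auto

lemma row_unique:
  assumes "cs \<in> coeff_lists m r" "ds \<in> coeff_lists m r"
    and "Y \<subseteq> set (row q cs)" "Y \<subseteq> set (row q ds)" "card Y = r" "1 \<le> r"
  shows "cs = ds"
proof -
  define I where "I = (\<lambda>y. int (y mod q)) ` Y"
  have "inj_on (\<lambda>y. int (y mod q)) Y"
  proof (rule inj_onI)
    fix x y assume "x \<in> Y" "y \<in> Y" "int (x mod q) = int (y mod q)"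
    then have "x mod q = y mod q" "x div q = y div q"
      using assms(3) by (auto simp: mem_set_row subset_iff)
    then show "x = y" by (metis div_mult_mod_eq)
  qed
  then have card: "card I = r" using assms(5) by (simp add: I_def card_image)
  have eq: "poly (Poly (map int cs)) x = poly (Poly (map int ds)) x" if x: "x \<in> I" for x
  proof -
    obtain y where y: "y \<in> Y" "x = int (y mod q)" using x by (auto simp: I_def)
    then have "poly (Poly cs) (y mod q) = poly (Poly ds) (y mod q)"
      using assms(3,4) unfolding mem_set_row subset_iff by metis
    then show ?thesis by (simp add: y(2) int_poly_Poly[symmetric])
  qed
  have deg: "degree (Poly (map int es)) < r" if "es \<in> coeff_lists m r" for es
    using that assms(6) by (intro degree_lessI) (auto simp: coeff_lists_def nth_default_def)
  have "Poly (map int cs) = Poly (map int ds)"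
    using eq deg assms(1,2) card by (intro poly_eqI_degree[of I]) auto
  then have *: "nth_default 0 (map int cs) k = nth_default 0 (map int ds) k" for k
    by (metis coeff_Poly_eq)
  show ?thesis
  proof (rule nth_equalityI)
    show "length cs = length ds" using assms(1,2) by (simp add: coeff_lists_def)
    then show "cs ! k = ds ! k" if "k < length cs" for k
      using *[of k] that by (simp add: nth_default_nth)
  qed
qed

text \<open>A letter prescribes one value of the polynomial, so the coefficients other than the constant
  one determine the row.\<close>

lemma card_rows_through_letter:
  assumes "1 \<le> r"
  shows "card {cs \<in> coeff_lists m r. y \<in> set (row q cs)} \<le> m ^ (r - 1)"
proof -
  let ?S = "{cs \<in> coeff_lists m r. y \<in> set (row q cs)}"
  have "inj_on tl ?S"
  proof (rule inj_onI)
    fix cs ds assume S: "cs \<in> ?S" "ds \<in> ?S" and tl: "tl cs = tl ds"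
    then obtain a b t where "cs = a # t" "ds = b # t"
      using assms by (cases cs; cases ds) (auto simp: coeff_lists_def)
    then show "cs = ds" using S by (auto simp: mem_set_row)
  qed
  moreover have "tl ` ?S \<subseteq> coeff_lists m (r - 1)"
    using assms by (auto simp: coeff_lists_def dest: list.set_sel(2)[rotated] intro: ccontr)
  ultimately show ?thesis
    using card_inj_on_le[of tl ?S "coeff_lists m (r - 1)"] finite_coeff_lists card_coeff_lists
    by simp
qed

lemma card_rows_meeting:
  assumes "1 \<le> r" "finite Y" "card Y = r"
  shows "card {cs \<in> coeff_lists m r. set (row q cs) \<inter> Y \<noteq> {}} \<le> r * m ^ (r - 1)"
proof -
  let ?S = "\<lambda>y. {cs \<in> coeff_lists m r. y \<in> set (row q cs)}"
  have "{cs \<in> coeff_lists m r. set (row q cs) \<inter> Y \<noteq> {}} = (\<Union>y\<in>Y. ?S y)" by auto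
  also have "card \<dots> \<le> (\<Sum>y\<in>Y. card (?S y))" by (intro card_UN_le assms)
  also have "\<dots> \<le> (\<Sum>y\<in>Y. m ^ (r - 1))"
    by (intro sum_mono card_rows_through_letter assms)
  finally show ?thesis by (simp add: assms)
qed

section \<open>The lower bound\<close>

lemma sparseI_nth:
  assumes "\<And>i k. i < k \<Longrightarrow> k < i + j \<Longrightarrow> k < length u \<Longrightarrow> u ! i \<noteq> u ! k"
  shows "sparse j u"
  unfolding sparse_def
proof (intro allI impI)
  fix v assume v: "sublist v u \<and> length v = j"
  then obtain xs ys where u: "u = xs @ v @ ys" by (auto simp: sublist_def)
  have "v ! a \<noteq> v ! b" if "a < b" "b < length v" for a b
    using assms[of "length xs + a" "length xs + b"] that v by (simp add: u nth_append)
  then show "distinct v" by (metis distinct_conv_nth nat_neq_iff)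
qed

lemma nth_mod_concat_cyclic:
  assumes "\<forall>x\<in>set rs. map (\<lambda>y. y mod q) x = [0..<q]" "t < length (concat rs)"
  shows "concat rs ! t mod q = t mod q"
  using assms
proof (induction rs arbitrary: t)
  case (Cons x rs)
  have x: "map (\<lambda>y. y mod q) x = [0..<q]" using Cons.prems(1) by simp
  then have len: "length x = q" by (metis diff_zero length_map length_upt)
  show ?case
  proof (cases "t < q")
    case True
    then have "x ! t mod q = map (\<lambda>y. y mod q) x ! t" using len by simp
    then show ?thesis using True x len by (simp add: nth_append)
  next
    case False
    then have "concat rs ! (t - q) mod q = (t - q) mod q"
      using Cons len by (intro Cons.IH) auto
    then show ?thesis using False len by (simp add: nth_append le_mod_geq)
  qed
qed simp

text \<open>Equal letters have equal residues modulo \<open>q\<close>. When the residues run through \<open>0, \<dots>, q - 1\<close>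
  cyclically, equal letters are therefore at least \<open>q\<close> places apart. Letters of \<open>e\<close> occur only
  once.\<close>

lemma sparse_cyclic_append:
  assumes "\<forall>x\<in>set rs. map (\<lambda>y. y mod q) x = [0..<q]"
    and "distinct e" "set e \<inter> set (concat rs) = {}"
  shows "sparse q (concat rs @ e)"
proof (rule sparseI_nth)
  fix i k assume ik: "i < k" "k < i + q" "k < length (concat rs @ e)"
  let ?u = "concat rs"
  consider "k < length ?u" | "i < length ?u" "length ?u \<le> k" | "length ?u \<le> i" by linarith
  then show "(?u @ e) ! i \<noteq> (?u @ e) ! k"
  proof cases
    case 1
    have "i mod q \<noteq> k mod q"
    proof
      assume "i mod q = k mod q"
      then have "q dvd k - i" using ik(1) by (metis mod_eq_dvd_iff_nat less_imp_le)
      then show False using ik by (auto dest: dvd_imp_le)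
    qed
    then have "?u ! i mod q \<noteq> ?u ! k mod q"
      using nth_mod_concat_cyclic[OF assms(1)] 1 ik(1) by simp
    then show ?thesis using 1 ik(1) by (auto simp: nth_append)
  next
    case 2
    have "?u ! i \<in> set ?u" "e ! (k - length ?u) \<in> set e"
      using 2 ik by (auto simp del: set_concat)
    then have "?u ! i \<noteq> e ! (k - length ?u)" using assms(3) by (metis disjoint_iff)
    then show ?thesis using 2 by (simp add: nth_append)
  next
    case 3
    then show ?thesis using assms(2) ik by (auto simp: nth_append nth_eq_iff_index_eq)
  qed
qed

text \<open>The letters that occur in no row are appended once, to reach exactly \<open>n\<close> letters. This tail
  is one more block; it has capacity at most \<open>2\<close>, which the hypothesis on \<open>s\<close> makes room for.\<close>

lemma F_ge_rows:
  assumes "1 \<le> r" "r \<le> q" "0 < m" "m * q ^ (r + 1) \<le> n" "t + r * m ^ (r - 1) + 2 < s"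
  shows "q * t * m ^ r \<le> F r s q n"
proof -
  define C where "C = coeff_lists m r"
  obtain css where css: "set css = C" "distinct css"
    using finite_distinct_list finite_coeff_lists C_def by metis
  define rs where "rs = concat (map (\<lambda>cs. replicate t (row q cs)) css)"
  define e where "e = filter (\<lambda>x. x \<notin> set (concat rs)) [0..<n]"
  define u where "u = concat rs @ e"
  define block where "block cs = concat (replicate t (row q cs))" for cs
  define bs where "bs = map block css @ [e]"
  have u_bs: "u = concat bs"
    unfolding u_def bs_def rs_def block_def by (induction css) auto
  have de: "distinct e" by (simp add: e_def)
  have rows: "\<exists>cs\<in>C. x = row q cs" if "x \<in> set rs" for x
    using that css(1) by (auto simp: rs_def split: if_splits)
  have "set (concat rs) \<subseteq> {..<n}"
    using rows set_row_subset[OF assms(3)] assms(4) unfolding C_def by fastforce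
  then have "set u = {..<n}" by (auto simp: u_def e_def)
  then have card_u: "card (set u) = n" by simp
  have "sparse q u"
    unfolding u_def
  proof (rule sparse_cyclic_append[OF _ de])
    show "\<forall>x\<in>set rs. map (\<lambda>y. y mod q) x = [0..<q]" using rows map_mod_row by blast
    show "set e \<inter> set (concat rs) = {}" by (auto simp: e_def)
  qed
  moreover have "avoids_formations r s u"
    unfolding avoids_formations_def
  proof (intro notI, elim exE conjE)
    fix v assume v: "subseq v u" "formation r s v"
    then obtain Y ps where f: "finite Y" "card Y = r" "length ps = s"
      "set ps \<subseteq> permutations_of_set Y" "v = concat ps" by (auto simp: formation_def)
    have ne: "Y \<noteq> {}" using f(2) assms(1) by auto
    have "\<forall>p\<in>set ps. set p = Y" using f(4) by (auto simp: permutations_of_set_def)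
    then have "s \<le> (\<Sum>b\<leftarrow>bs. capacity Y b)"
      using length_le_sum_capacity[OF f(1) ne, of ps bs] v(1) f by (simp add: u_bs)
    also have "\<dots> = (\<Sum>cs\<in>C. capacity Y (block cs)) + capacity Y e"
      by (simp add: bs_def comp_def sum_list_distinct_conv_sum_set css)
    also have "capacity Y e \<le> 2"
    proof -
      obtain y where "y \<in> Y" using ne by blast
      then show ?thesis using capacity_le[OF f(1), of y e] count_list_distinct_le[OF de, of y] by simp
    qed
    also have "(\<Sum>cs\<in>C. capacity Y (block cs)) \<le> t + r * m ^ (r - 1)"
    proof -
      have fin: "finite C" by (simp add: C_def finite_coeff_lists)
      have "(\<Sum>cs\<in>C. capacity Y (block cs)) \<le> (\<Sum>cs\<in>C.
          (if set (row q cs) \<inter> Y \<noteq> {} then 1 else 0) + (if Y \<subseteq> set (row q cs) then t else 0))"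
        unfolding block_def by (intro sum_mono capacity_repeated_le f(1) ne distinct_row)
      also have "\<dots> = card {cs \<in> C. set (row q cs) \<inter> Y \<noteq> {}} + card {cs \<in> C. Y \<subseteq> set (row q cs)} * t"
        using fin by (simp add: sum.distrib sum.If_cases Int_def)
      also have "\<dots> \<le> r * m ^ (r - 1) + 1 * t"
      proof (intro add_mono mult_le_mono1)
        show "card {cs \<in> C. set (row q cs) \<inter> Y \<noteq> {}} \<le> r * m ^ (r - 1)"
          unfolding C_def by (rule card_rows_meeting[OF assms(1) f(1,2)])
        have "cs = ds" if "cs \<in> {cs \<in> C. Y \<subseteq> set (row q cs)}" "ds \<in> {cs \<in> C. Y \<subseteq> set (row q cs)}" for cs ds
          using row_unique[of cs m r ds Y q] that f(2) assms(1) by (simp add: C_def)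
        then show "card {cs \<in> C. Y \<subseteq> set (row q cs)} \<le> 1"
          using fin by (subst card_le_Suc0_iff_eq[unfolded One_nat_def[symmetric]]) auto
      qed
      finally show ?thesis by simp
    qed
    finally show False using assms(5) by simp
  qed
  ultimately have "length u \<in> admissible_lengths r s q n"
    using card_u by (auto simp: admissible_lengths_def)
  then have "length u \<le> F r s q n"
    unfolding F_def using finite_admissible_lengths[of r q s n] assms(1,2,5) by (intro Max_ge) auto
  moreover have "length (concat (map block cs)) = length cs * (t * q)" for cs
    by (induction cs) (auto simp: block_def length_concat sum_list_replicate row_def)
  moreover have "length css = m ^ r"
    using css distinct_card[of css] by (simp add: C_def card_coeff_lists)
  ultimately show ?thesis by (simp add: u_bs bs_def mult.commute mult.left_commute)
qed

text \<open>The factor \<open>\<epsilon>\<close> with \<open>m = \<lfloor>\<epsilon> * n\<rfloor>\<close> must keep the letters below \<open>n\<close> and the number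
  \<open>r * m ^ (r - 1)\<close> of rows that meet an \<open>r\<close>-set below \<open>s / 4\<close>; \<open>\<epsilon> = c / (4 * q ^ (r + 1))\<close>
  does both, since \<open>r \<le> q ^ (r + 1)\<close> and \<open>\<epsilon> ^ (r - 1) \<le> \<epsilon>\<close>. Taking \<open>s div 2\<close> copies of each row
  then leaves a quarter of \<open>s\<close> for the appended tail, whence \<open>s \<ge> 16\<close> suffices.\<close>

lemma F_ge:
  fixes c :: real
  assumes "2 \<le> r" "r \<le> q" "0 < c" "c \<le> 1"
    and n: "c / (4 * real q ^ (r + 1)) * real n \<ge> 2"
    and s: "16 \<le> s" "c * real n ^ (r - 1) \<le> real s"
  shows "(c / (4 * real q ^ (r + 1)) / 2) ^ r / 4 * (real s * real n ^ r) \<le> real (F r s q n)"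
proof -
  define L where "L = real q ^ (r + 1)"
  define \<epsilon> where "\<epsilon> = c / (4 * L)"
  define m where "m = nat \<lfloor>\<epsilon> * real n\<rfloor>"
  define t where "t = s div 2"
  have q: "1 \<le> real q" using assms(1,2) by simp
  have "real q ^ 1 \<le> L" unfolding L_def using q by (intro power_increasing) auto
  then have L: "real r \<le> L" "1 \<le> L" using assms(1,2) q by auto
  have eps: "0 < \<epsilon>" "\<epsilon> \<le> 1" using L assms(3,4) by (auto simp: \<epsilon>_def divide_simps)
  have n2: "\<epsilon> * real n \<ge> 2" using n by (simp add: \<epsilon>_def L_def)
  have m_le: "real m \<le> \<epsilon> * real n" and m_ge: "\<epsilon> * real n / 2 \<le> real m" and m_pos: "0 < m"
    unfolding m_def using n2 by linarith+
  have letters: "m * q ^ (r + 1) \<le> n"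
  proof -
    have "real m * L \<le> \<epsilon> * real n * L" using m_le L by (intro mult_right_mono) auto
    also have "\<dots> = c / 4 * real n" using L by (simp add: \<epsilon>_def)
    also have "\<dots> \<le> 1 * real n" using assms(4) by (intro mult_right_mono) auto
    finally have "real (m * q ^ (r + 1)) \<le> real n" by (simp add: L_def)
    then show ?thesis by linarith
  qed
  have rows: "real (r * m ^ (r - 1)) \<le> real s / 4"
  proof -
    have "real (r * m ^ (r - 1)) \<le> real r * (\<epsilon> * real n) ^ (r - 1)"
      using m_le by (auto intro!: mult_left_mono power_mono)
    also have "\<dots> = real r * \<epsilon> ^ (r - 1) * real n ^ (r - 1)" by (simp add: power_mult_distrib)
    also have "\<dots> \<le> L * \<epsilon> ^ 1 * real n ^ (r - 1)"
      using eps L assms(1) by (intro mult_right_mono mult_mono power_decreasing) auto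
    also have "\<dots> = c * real n ^ (r - 1) / 4" using L by (simp add: \<epsilon>_def)
    also have "\<dots> \<le> real s / 4" using s(2) by simp
    finally show ?thesis .
  qed
  have "real t \<le> real s / 2" and t: "real s / 4 \<le> real t"
    unfolding t_def using s(1) by linarith+
  then have "t + r * m ^ (r - 1) + 2 < s" using rows s(1) by linarith
  then have "q * t * m ^ r \<le> F r s q n"
    using assms(1,2) m_pos letters by (intro F_ge_rows) auto
  then have F: "real q * real t * real m ^ r \<le> real (F r s q n)"
    by (metis of_nat_le_iff of_nat_mult of_nat_power)
  have "(\<epsilon> / 2) ^ r / 4 * (real s * real n ^ r) = real s / 4 * (\<epsilon> * real n / 2) ^ r"
    by (simp add: power_mult_distrib power_divide mult.commute mult.left_commute)
  also have "\<dots> \<le> real t * real m ^ r"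
    using t m_ge eps by (intro mult_mono power_mono) auto
  also have "\<dots> \<le> real q * (real t * real m ^ r)"
    using mult_right_mono[OF q, of "real t * real m ^ r"] by simp
  finally show ?thesis using F by (simp add: \<epsilon>_def L_def mult.assoc)
qed

theorem theorem2p3:
  shows "\<exists>C::real. 0 < C \<and>
    (\<forall>(q::nat) (r::nat) (c::real). r \<le> q \<and> 2 \<le> r \<and> 0 < c \<and> c \<le> 1 \<longrightarrow>
      (\<exists>D::real. 0 < D \<and>
        (\<forall>\<^sub>F n::nat in at_top. \<forall>s::nat. 1 \<le> s \<and> c * real n ^ (r - 1) \<le> real s \<longrightarrow>
          D * (real s * real n ^ r) \<le> real (F r s q n) \<and>
          real (F r s q n) \<le> C * (real s * real n ^ r))))"
proof (rule exI[of _ "1::real"], intro conjI allI impI)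
  fix q r :: nat and c :: real
  assume asm: "r \<le> q \<and> 2 \<le> r \<and> 0 < c \<and> c \<le> 1"
  define \<epsilon> where "\<epsilon> = c / (4 * real q ^ (r + 1))"
  have eps: "0 < \<epsilon>" using asm by (simp add: \<epsilon>_def)
  have large: "\<forall>\<^sub>F n::nat in at_top. M \<le> real n" for M :: real
    using filterlim_real_sequentially by (auto simp: filterlim_at_top)
  show "\<exists>D::real. 0 < D \<and>
        (\<forall>\<^sub>F n::nat in at_top. \<forall>s::nat. 1 \<le> s \<and> c * real n ^ (r - 1) \<le> real s \<longrightarrow>
          D * (real s * real n ^ r) \<le> real (F r s q n) \<and>
          real (F r s q n) \<le> 1 * (real s * real n ^ r))"
  proof (intro exI[of _ "(\<epsilon> / 2) ^ r / 4"] conjI)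
    show "0 < (\<epsilon> / 2) ^ r / 4" using eps by simp
    show "\<forall>\<^sub>F n::nat in at_top. \<forall>s::nat. 1 \<le> s \<and> c * real n ^ (r - 1) \<le> real s \<longrightarrow>
          (\<epsilon> / 2) ^ r / 4 * (real s * real n ^ r) \<le> real (F r s q n) \<and>
          real (F r s q n) \<le> 1 * (real s * real n ^ r)"
      using large[of q] large[of "2 / \<epsilon>"] large[of "16 / c"]
    proof eventually_elim
      case (elim n)
      show ?case
      proof (intro allI impI)
        fix s :: nat assume s: "1 \<le> s \<and> c * real n ^ (r - 1) \<le> real s"
        have q: "q \<le> n" using elim(1) by simp
        have "16 \<le> c * real n" using elim(3) asm by (simp add: field_simps)
        also have "\<dots> \<le> c * real n ^ (r - 1)"
          using asm q by (intro mult_left_mono self_le_power) auto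
        finally have s16: "16 \<le> s" using s by linarith
        have "2 \<le> \<epsilon> * real n" using elim(2) eps by (simp add: field_simps)
        then have "(\<epsilon> / 2) ^ r / 4 * (real s * real n ^ r) \<le> real (F r s q n)"
          unfolding \<epsilon>_def using asm s s16 by (intro F_ge) auto
        moreover have "F r s q n \<le> s * n ^ r" using asm s16 q by (intro F_le) auto
        then have "real (F r s q n) \<le> 1 * (real s * real n ^ r)"
          by (metis mult_1 of_nat_le_iff of_nat_mult of_nat_power)
        ultimately show "(\<epsilon> / 2) ^ r / 4 * (real s * real n ^ r) \<le> real (F r s q n) \<and>
          real (F r s q n) \<le> 1 * (real s * real n ^ r)" by blast
      qed
    qed
  qed
qed simp

end
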